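(* There exist real normed spaces $F$ and $G$ and a continuous nonlinear operator $S:F\to G$ such that $$\lim_{n\to\infty}\widetilde e_n^{\rm \,all\text{-}wor}(S)=\lim_{n\to\infty}e_n^{\rm all\text{-}wor}(S)>0\qquad\text{and}\qquad\lim_{n\to\infty}e_n^{\rm all\text{-}ran}(S)=0.$$
   Context: Let $\Lambda^{\rm all}$ be the class of all continuous linear functionals $F\to\mathbb{R}$ and $\widetilde\Lambda^{\rm all}$ the class of all linear functionals $F\to\mathbb{R}$, continuous or not. Worst case setting. For an integer $n\ge0$, a deterministic algorithm $A_n:F\to G$ using $n$ functionals from a class $\Lambda$ is a mapping $A_n(f)=\phi_n(y_1,\dots,y_n)$ with $y_j=L_j(f;y_1,\dots,y_{j-1})$, where $\phi_n:\mathbb{R}^n\to G$ is arbitrary and $L_j(\cdot\,;y_1,\dots,y_{j-1})\in\Lambda$ for all $j$ and all $y_1,\dots,y_{j-1}\in\mathbb{R}$ (adaptive choice of functionals is allowed; for $n=0$, $A_0$ is constant). Its worst case error is $e(A_n)=\sup_{\|f\|_F<1}\|S(f)-A_n(f)\|_G$. The numbers $e_n^{\rm all\text{-}wor}(S)$ and $\widetilde e_n^{\rm \,all\text{-}wor}(S)$ are the infima of $e(A_n)$ over all algorithms $A_n$ using $n$ functionals from $\Lambda^{\rm all}$ and from $\widetilde\Lambda^{\rm all}$, respectively. Randomized setting. A randomized algorithm $A$ using functionals from $\Lambda$ consists of a probability space $(\Omega,\Sigma,\mu)$ and a family $(N_\omega,\phi_\omega)_{\omega\in\Omega}$ such that: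 (1) for each fixed $\omega$, $A_\omega=\phi_\omega\circ N_\omega$ is a deterministic algorithm based on adaptive information $N_\omega$ consisting of linear functionals from $\Lambda$ (the number of functionals used may also vary with $f$, being determined adaptively from the computed values); (2) if $n(f,\omega)$ denotes the number of functionals used by $N_\omega$ for $f\in F$, then the function $n$ is measurable; (3) the mapping $(f,\omega)\mapsto\phi_\omega(N_\omega(f))\in G$ is measurable. Measurability is with respect to the Borel $\sigma$-fields on $F$ and $G$ and the $\sigma$-field $\Sigma$ on $\Omega$. The cardinality and the error of $A$ are $$n(A)=\sup_{\|f\|_F<1}\int_\Omega n(f,\omega)\,d\mu(\omega),\qquad e^{\rm ran}(A)=\sup_{\|f\|_F<1}\left(\int_\Omega\|S(f)-\phi_\omega(N_\omega(f))\|_G^2\,d\mu(\omega)\right)^{1/2},$$ and $$e_n^{\rm all\text{-}ran}(S)=\inf\{e^{\rm ran}(A): A\text{ uses functionals from }\Lambda^{\rm all},\ n(A)\le n\}.$$ *)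

theory Defs
  imports "HOL-Probability.Probability"
begin

section \<open>Real normed spaces with explicit carrier\<close>

text \<open>
  Existence of a normed space cannot be expressed by quantifying over types of class
  \<^class>\<open>real_normed_vector\<close>, so a normed space is a structure on a subset of a type.
\<close>

record 'a nspace =
  carr :: "'a set"
  vzero :: 'a
  vadd :: "'a \<Rightarrow> 'a \<Rightarrow> 'a"
  vscale :: "real \<Rightarrow> 'a \<Rightarrow> 'a"
  vnorm :: "'a \<Rightarrow> real"

locale real_normed_space =
  fixes E :: "'a nspace" (structure)
  assumes zero_closed: "vzero E \<in> carr E"
    and add_closed: "\<lbrakk>x \<in> carr E; y \<in> carr E\<rbrakk> \<Longrightarrow> vadd E x y \<in> carr E"
    and scale_closed: "x \<in> carr E \<Longrightarrow> vscale E a x \<in> carr E"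
    and add_assoc: "\<lbrakk>x \<in> carr E; y \<in> carr E; z \<in> carr E\<rbrakk>
          \<Longrightarrow> vadd E (vadd E x y) z = vadd E x (vadd E y z)"
    and add_commute: "\<lbrakk>x \<in> carr E; y \<in> carr E\<rbrakk> \<Longrightarrow> vadd E x y = vadd E y x"
    and add_zero: "x \<in> carr E \<Longrightarrow> vadd E x (vzero E) = x"
    and add_inverse: "x \<in> carr E \<Longrightarrow> vadd E x (vscale E (- 1) x) = vzero E"
    and scale_add_right: "\<lbrakk>x \<in> carr E; y \<in> carr E\<rbrakk>
          \<Longrightarrow> vscale E a (vadd E x y) = vadd E (vscale E a x) (vscale E a y)"
    and scale_add_left: "x \<in> carr E
          \<Longrightarrow> vscale E (a + b) x = vadd E (vscale E a x) (vscale E b x)"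
    and scale_scale: "x \<in> carr E \<Longrightarrow> vscale E a (vscale E b x) = vscale E (a * b) x"
    and scale_one: "x \<in> carr E \<Longrightarrow> vscale E 1 x = x"
    and norm_nonneg: "x \<in> carr E \<Longrightarrow> 0 \<le> vnorm E x"
    and norm_eq_zero: "x \<in> carr E \<Longrightarrow> vnorm E x = 0 \<longleftrightarrow> x = vzero E"
    and norm_scale: "x \<in> carr E \<Longrightarrow> vnorm E (vscale E a x) = \<bar>a\<bar> * vnorm E x"
    and norm_triangle: "\<lbrakk>x \<in> carr E; y \<in> carr E\<rbrakk>
          \<Longrightarrow> vnorm E (vadd E x y) \<le> vnorm E x + vnorm E y"

definition vdiff :: "'a nspace \<Rightarrow> 'a \<Rightarrow> 'a \<Rightarrow> 'a" where
  "vdiff E x y = vadd E x (vscale E (- 1) y)"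

text \<open>The value outside the carrier is irrelevant; it is fixed because the locale
  \<^locale>\<open>Metric_space\<close> requires nonnegativity and symmetry on the whole type.\<close>

definition vdist :: "'a nspace \<Rightarrow> 'a \<Rightarrow> 'a \<Rightarrow> real" where
  "vdist E x y = (if x \<in> carr E \<and> y \<in> carr E then vnorm E (vdiff E x y) else 0)"

definition ntop :: "'a nspace \<Rightarrow> 'a topology" where
  "ntop E = Metric_space.mtopology (carr E) (vdist E)"

definition nborel :: "'a nspace \<Rightarrow> 'a measure" where
  "nborel E = sigma (carr E) {U. openin (ntop E) U}"

definition open_unit_ball :: "'a nspace \<Rightarrow> 'a set" where
  "open_unit_ball E = {x \<in> carr E. vnorm E x < 1}"

lemma (in real_normed_space) Metric_space_vdist: "Metric_space (carr E) (vdist E)"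
proof
  have neg_closed: "vscale E (- 1) x \<in> carr E" if "x \<in> carr E" for x
    using that by (rule scale_closed)
  have diff_closed: "vdiff E x y \<in> carr E" if "x \<in> carr E" "y \<in> carr E" for x y
    unfolding vdiff_def using that by (intro add_closed neg_closed)
  have swap: "vdiff E y x = vscale E (- 1) (vdiff E x y)" if "x \<in> carr E" "y \<in> carr E" for x y
  proof -
    have "vscale E (- 1) (vdiff E x y) = vadd E (vscale E (- 1) x) (vscale E (- 1) (vscale E (- 1) y))"
      unfolding vdiff_def by (rule scale_add_right[OF that(1) neg_closed[OF that(2)]])
    also have "vscale E (- 1) (vscale E (- 1) y) = y"
      using scale_scale[OF that(2), of "- 1" "- 1"] scale_one[OF that(2)] by simp
    also have "vadd E (vscale E (- 1) x) y = vdiff E y x"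
      unfolding vdiff_def by (rule add_commute[OF neg_closed[OF that(1)] that(2)])
    finally show ?thesis by (rule sym)
  qed
  have neg_add: "vadd E (vscale E (- 1) y) (vadd E y z) = z" if "y \<in> carr E" "z \<in> carr E" for y z
  proof -
    have "vadd E (vscale E (- 1) y) (vadd E y z) = vadd E (vadd E (vscale E (- 1) y) y) z"
      by (rule sym, rule add_assoc[OF neg_closed[OF that(1)] that])
    also have "vadd E (vscale E (- 1) y) y = vzero E"
      using add_commute[OF neg_closed[OF that(1)] that(1)] add_inverse[OF that(1)]
      by (rule trans)
    also have "vadd E (vzero E) z = z"
      using add_commute[OF zero_closed that(2)] add_zero[OF that(2)] by (rule trans)
    finally show ?thesis .
  qed
  have cancel: "vadd E (vdiff E x y) y = x" if "x \<in> carr E" "y \<in> carr E" for x y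
  proof -
    have "vadd E (vdiff E x y) y = vadd E x (vadd E (vscale E (- 1) y) y)"
      unfolding vdiff_def by (rule add_assoc[OF that(1) neg_closed[OF that(2)] that(2)])
    also have "vadd E (vscale E (- 1) y) y = vzero E"
      using add_commute[OF neg_closed[OF that(2)] that(2)] add_inverse[OF that(2)]
      by (rule trans)
    also have "vadd E x (vzero E) = x" by (rule add_zero[OF that(1)])
    finally show ?thesis .
  qed
  have split: "vadd E (vdiff E x y) (vdiff E y z) = vdiff E x z"
    if "x \<in> carr E" "y \<in> carr E" "z \<in> carr E" for x y z
  proof -
    have "vadd E (vdiff E x y) (vdiff E y z)
        = vadd E x (vadd E (vscale E (- 1) y) (vadd E y (vscale E (- 1) z)))"
      unfolding vdiff_def
      by (rule add_assoc[OF that(1) neg_closed[OF that(2)] add_closed[OF that(2) neg_closed[OF that(3)]]])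
    also have "vadd E (vscale E (- 1) y) (vadd E y (vscale E (- 1) z)) = vscale E (- 1) z"
      by (rule neg_add[OF that(2) neg_closed[OF that(3)]])
    finally show ?thesis unfolding vdiff_def .
  qed
  show "0 \<le> vdist E x y" for x y
    by (simp add: vdist_def norm_nonneg diff_closed)
  show "vdist E x y = vdist E y x" for x y
  proof (cases "x \<in> carr E \<and> y \<in> carr E")
    case True
    then have "vnorm E (vdiff E y x) = vnorm E (vdiff E x y)"
      using swap[of x y] norm_scale[OF diff_closed[of x y], of "- 1"] by simp
    with True show ?thesis by (simp add: vdist_def)
  qed (auto simp: vdist_def)
  show "vdist E x y = 0 \<longleftrightarrow> x = y" if "x \<in> carr E" "y \<in> carr E" for x y
  proof -
    have "x = y" if "vdiff E x y = vzero E"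
    proof -
      have "x = vadd E (vzero E) y"
        using cancel[OF \<open>x \<in> carr E\<close> \<open>y \<in> carr E\<close>] that by simp
      also have "\<dots> = vadd E y (vzero E)"
        by (rule add_commute[OF zero_closed \<open>y \<in> carr E\<close>])
      also have "\<dots> = y" by (rule add_zero[OF \<open>y \<in> carr E\<close>])
      finally show ?thesis .
    qed
    moreover have "vdiff E x x = vzero E"
      unfolding vdiff_def by (rule add_inverse[OF that(1)])
    ultimately show ?thesis
      using that norm_eq_zero[OF diff_closed[OF that]] by (auto simp: vdist_def)
  qed
  show "vdist E x z \<le> vdist E x y + vdist E y z"
    if "x \<in> carr E" "y \<in> carr E" "z \<in> carr E" for x y z
    using that norm_triangle[of "vdiff E x y" "vdiff E y z"] split[of x y z]
    by (simp add: vdist_def diff_closed)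
qed

lemma (in real_normed_space) topspace_ntop: "topspace (ntop E) = carr E"
  unfolding ntop_def by (rule Metric_space.topspace_mtopology[OF Metric_space_vdist])

lemma (in real_normed_space) space_nborel: "space (nborel E) = carr E"
proof -
  have "{U. openin (ntop E) U} \<subseteq> Pow (carr E)"
    using openin_subset topspace_ntop by blast
  then show ?thesis by (simp add: nborel_def)
qed

definition type_nspace :: "'a::real_normed_vector nspace" where
  "type_nspace = \<lparr>carr = UNIV, vzero = 0, vadd = (+), vscale = scaleR, vnorm = norm\<rparr>"

lemma real_normed_space_type: "real_normed_space type_nspace"
  by unfold_locales
    (auto simp: type_nspace_def add.assoc add.commute scaleR_add_right scaleR_add_left
      norm_triangle_ineq)

lemma ntop_type: "ntop type_nspace = euclidean"
proof -
  have "vdist (type_nspace :: 'a nspace) = dist"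
    by (auto simp: vdist_def vdiff_def type_nspace_def dist_norm fun_eq_iff)
  then show ?thesis
    by (simp add: ntop_def) (simp add: type_nspace_def)
qed

lemma nborel_type: "nborel type_nspace = borel"
  unfolding nborel_def ntop_type by (simp add: borel_def type_nspace_def)


section \<open>Operators and functionals\<close>

definition linear_operator :: "'a nspace \<Rightarrow> 'b nspace \<Rightarrow> ('a \<Rightarrow> 'b) \<Rightarrow> bool" where
  "linear_operator F G T \<longleftrightarrow>
     (\<forall>x\<in>carr F. T x \<in> carr G) \<and>
     (\<forall>x\<in>carr F. \<forall>y\<in>carr F. T (vadd F x y) = vadd G (T x) (T y)) \<and>
     (\<forall>a. \<forall>x\<in>carr F. T (vscale F a x) = vscale G a (T x))"

definition linear_functionals :: "'a nspace \<Rightarrow> ('a \<Rightarrow> real) set" where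
  "linear_functionals F = {L. linear_operator F type_nspace L}"

definition continuous_linear_functionals :: "'a nspace \<Rightarrow> ('a \<Rightarrow> real) set" where
  "continuous_linear_functionals F =
     {L \<in> linear_functionals F. continuous_map (ntop F) euclideanreal L}"


section \<open>Worst case setting\<close>

text \<open>
  The functional \<open>L\<^sub>j(\<cdot>; y\<^sub>1, \<dots>, y\<^sub>j\<^sub>-\<^sub>1)\<close> is \<open>L [y\<^sub>1, \<dots>, y\<^sub>j\<^sub>-\<^sub>1]\<close>; the index \<open>j\<close> is
  recovered from the length of the list.
\<close>

primrec info :: "(real list \<Rightarrow> 'a \<Rightarrow> real) \<Rightarrow> 'a \<Rightarrow> nat \<Rightarrow> real list" where
  "info L f 0 = []"
| "info L f (Suc k) = info L f k @ [L (info L f k) f]"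

definition det_algs ::
  "('a \<Rightarrow> real) set \<Rightarrow> 'b nspace \<Rightarrow> nat \<Rightarrow> ('a \<Rightarrow> 'b) set" where
  "det_algs \<Lambda> G n = {A. \<exists>L \<phi>.
      (\<forall>ys. length ys < n \<longrightarrow> L ys \<in> \<Lambda>) \<and>
      (\<forall>ys. length ys = n \<longrightarrow> \<phi> ys \<in> carr G) \<and>
      A = (\<lambda>f. \<phi> (info L f n))}"

definition wor_error ::
  "'a nspace \<Rightarrow> 'b nspace \<Rightarrow> ('a \<Rightarrow> 'b) \<Rightarrow> ('a \<Rightarrow> 'b) \<Rightarrow> ennreal" where
  "wor_error F G S A = (SUP f\<in>open_unit_ball F. ennreal (vnorm G (vdiff G (S f) (A f))))"

definition e_wor ::
  "('a \<Rightarrow> real) set \<Rightarrow> 'a nspace \<Rightarrow> 'b nspace \<Rightarrow> ('a \<Rightarrow> 'b) \<Rightarrow> nat \<Rightarrow> ennreal" where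
  "e_wor \<Lambda> F G S n = (INF A\<in>det_algs \<Lambda> G n. wor_error F G S A)"


section \<open>Randomized setting\<close>

text \<open>
  For each \<open>\<omega>\<close> the adaptive choice of the number of functionals is given by a stopping rule
  \<open>rstop\<close>, which decides from the values computed so far whether to stop.
\<close>

record ('w, 'a, 'b) ran_alg =
  rprob :: "'w measure"
  rfun :: "'w \<Rightarrow> real list \<Rightarrow> 'a \<Rightarrow> real"
  rstop :: "'w \<Rightarrow> real list \<Rightarrow> bool"
  rout :: "'w \<Rightarrow> real list \<Rightarrow> 'b"

definition num_funs :: "('w, 'a, 'b) ran_alg \<Rightarrow> 'a \<Rightarrow> 'w \<Rightarrow> nat" where
  "num_funs A f \<omega> = (LEAST k. rstop A \<omega> (info (rfun A \<omega>) f k))"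

definition ran_output :: "('w, 'a, 'b) ran_alg \<Rightarrow> 'a \<Rightarrow> 'w \<Rightarrow> 'b" where
  "ran_output A f \<omega> = rout A \<omega> (info (rfun A \<omega>) f (num_funs A f \<omega>))"

definition ran_algs ::
  "('a \<Rightarrow> real) set \<Rightarrow> 'a nspace \<Rightarrow> 'b nspace \<Rightarrow> ('w, 'a, 'b) ran_alg set" where
  "ran_algs \<Lambda> F G = {A.
      prob_space (rprob A) \<and>
      (\<forall>\<omega>\<in>space (rprob A).
         (\<forall>ys. rfun A \<omega> ys \<in> \<Lambda>) \<and>
         (\<forall>ys. rout A \<omega> ys \<in> carr G) \<and>
         (\<forall>f\<in>carr F. \<exists>k. rstop A \<omega> (info (rfun A \<omega>) f k))) \<and>
      (\<lambda>(f, \<omega>). num_funs A f \<omega>) \<in> measurable (nborel F \<Otimes>\<^sub>M rprob A) (count_space UNIV) \<and>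
      (\<lambda>(f, \<omega>). ran_output A f \<omega>) \<in> measurable (nborel F \<Otimes>\<^sub>M rprob A) (nborel G)}"

definition ran_card :: "'a nspace \<Rightarrow> ('w, 'a, 'b) ran_alg \<Rightarrow> ennreal" where
  "ran_card F A =
     (SUP f\<in>open_unit_ball F. \<integral>\<^sup>+\<omega>. of_nat (num_funs A f \<omega>) \<partial>rprob A)"

definition ennreal_sqrt :: "ennreal \<Rightarrow> ennreal" where
  "ennreal_sqrt x = (if x = \<infinity> then \<infinity> else ennreal (sqrt (enn2real x)))"

definition ran_error ::
  "'a nspace \<Rightarrow> 'b nspace \<Rightarrow> ('a \<Rightarrow> 'b) \<Rightarrow> ('w, 'a, 'b) ran_alg \<Rightarrow> ennreal" where
  "ran_error F G S A = (SUP f\<in>open_unit_ball F.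
     ennreal_sqrt (\<integral>\<^sup>+\<omega>. ennreal ((vnorm G (vdiff G (S f) (ran_output A f \<omega>)))\<^sup>2) \<partial>rprob A))"

text \<open>The first argument fixes the type that carries the sample spaces \<open>\<Omega>\<close> over which the
  infimum is taken.  Sample spaces are arbitrary probability spaces on subsets of that type.\<close>

definition e_ran ::
  "'w itself \<Rightarrow> ('a \<Rightarrow> real) set \<Rightarrow> 'a nspace \<Rightarrow> 'b nspace \<Rightarrow> ('a \<Rightarrow> 'b) \<Rightarrow> nat \<Rightarrow> ennreal" where
  "e_ran W \<Lambda> F G S n =
     (INF A\<in>{A :: ('w, 'a, 'b) ran_alg. A \<in> ran_algs \<Lambda> F G \<and> ran_card F A \<le> of_nat n}.
        ran_error F G S A)"

end

(* The operator is the mean absolute value S(f) = integral over [0,1] of |f|, on a space of functions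
  with the sup norm and continuous point evaluations.  Monte Carlo with n random points has
  root mean square error at most 1 / sqrt n on the unit ball.  In the worst case setting, n linear
  functionals, continuous or not, vanish on a step function with N pieces and values in [-1, 1] at
  least N - n of which are 1 or -1.  Such a function has S(f) >= 1 - n / N and cannot be distinguished
  from 0, so that the error is exactly 1/2 for all n. *)

theory Submission
  imports Defs
begin


section \<open>Nonexpansive maps between normed spaces\<close>

text \<open>The absolute value is what defeats linear data: the mean of \<open>f\<close> itself is a
  linear functional and one evaluation would settle it, whereas sign changes between pieces can
  satisfy \<open>n\<close> linear conditions while \<bar>f\<bar> stays 1 on most pieces. For fixed
  \<open>n\<close> the number of pieces must be unbounded, so the domain has to contain step
  functions of every level. The obstacle is on the randomized side. The output must be measurable
  jointly in the input and the sample, for the product of the Borel \<sigma>-fields, and evaluating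
  step functions is not continuous in the point. Hence the domain consists of sequences, and a point
  value is a limit of countably many coordinates chosen measurably by the point.\<close>

lemma nonexpansive_continuous_map:
  assumes "real_normed_space E" "real_normed_space E'"
    and maps: "\<And>x. x \<in> carr E \<Longrightarrow> T x \<in> carr E'"
    and le: "\<And>x y. x \<in> carr E \<Longrightarrow> y \<in> carr E \<Longrightarrow>
      vnorm E' (vdiff E' (T x) (T y)) \<le> vnorm E (vdiff E x y)"
  shows "continuous_map (ntop E) (ntop E') T"
proof -
  interpret M: Metric_space "carr E" "vdist E"
    using assms(1) by (rule real_normed_space.Metric_space_vdist)
  have M': "Metric_space (carr E') (vdist E')"
    using assms(2) by (rule real_normed_space.Metric_space_vdist)
  have "vdist E' (T x) (T y) \<le> vdist E x y" if "x \<in> carr E" "y \<in> carr E" for x y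
    using that maps le by (simp add: vdist_def)
  then show ?thesis
    unfolding ntop_def M.metric_continuous_map[OF M']
    using maps by (meson image_subsetI le_less_trans)
qed

lemma continuous_map_measurable_nborel:
  assumes "real_normed_space E" "real_normed_space E'"
    and T: "continuous_map (ntop E) (ntop E') T"
  shows "T \<in> measurable (nborel E) (nborel E')"
proof -
  have sp: "topspace (ntop E) = carr E" "topspace (ntop E') = carr E'"
    using assms(1,2) by (auto simp: real_normed_space.topspace_ntop)
  have "T \<in> measurable (nborel E) (sigma (carr E') {U. openin (ntop E') U})"
  proof (rule measurable_sigma_sets)
    show "sets (sigma (carr E') {U. openin (ntop E') U}) = sigma_sets (carr E') {U. openin (ntop E') U}"
      using sp(2) openin_subset by (intro sets_measure_of) blast
    show "{U. openin (ntop E') U} \<subseteq> Pow (carr E')"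
      using sp(2) openin_subset by blast
    show "T \<in> space (nborel E) \<rightarrow> carr E'"
      using T sp by (auto simp: real_normed_space.space_nborel[OF assms(1)] continuous_map_def)
    fix U assume "U \<in> {U. openin (ntop E') U}"
    then have "openin (ntop E) {x \<in> carr E. T x \<in> U}"
      using T sp by (auto simp: continuous_map_def)
    moreover have "T -` U \<inter> space (nborel E) = {x \<in> carr E. T x \<in> U}"
      by (auto simp: real_normed_space.space_nborel[OF assms(1)])
    moreover have "{U. openin (ntop E) U} \<subseteq> Pow (carr E)"
      using sp(1) openin_subset by blast
    ultimately show "T -` U \<inter> space (nborel E) \<in> sets (nborel E)"
      by (simp add: nborel_def)
  qed
  then show ?thesis by (simp add: nborel_def)
qed

section \<open>The cube and subspaces of small codimension\<close>

text \<open>Gaussian elimination, by induction on the number of equations. If equation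
  \<open>n\<close> has a nonzero coefficient at \<open>p\<close>, it is solved for the unknown
  \<open>p\<close> and substituted into the others. This leaves one equation and one unknown fewer,
  and a nontrivial solution \<open>g\<close> of the reduced system extends to
  \<open>p\<close>.\<close>

lemma underdetermined_system:
  fixes a :: "nat \<Rightarrow> 'i \<Rightarrow> real"
  assumes "finite I" "n < card I"
  shows "\<exists>h. (\<exists>i\<in>I. h i \<noteq> 0) \<and> (\<forall>j<n. (\<Sum>i\<in>I. h i * a j i) = 0)"
  using assms
proof (induction n arbitrary: I a)
  case 0
  then have "I \<noteq> {}" by auto
  then show ?case by (intro exI[of _ "\<lambda>_. 1"]) auto
next
  case (Suc n)
  show ?case
  proof (cases "\<forall>i\<in>I. a n i = 0")
    case True
    obtain h where h: "\<exists>i\<in>I. h i \<noteq> 0" "\<forall>j<n. (\<Sum>i\<in>I. h i * a j i) = 0"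
      using Suc.IH[of I a] Suc.prems by auto
    have "(\<Sum>i\<in>I. h i * a n i) = 0" using True by simp
    with h show ?thesis by (metis less_Suc_eq)
  next
    case False
    then obtain p where p: "p \<in> I" "a n p \<noteq> 0" by auto
    define J where "J = I - {p}"
    have J: "finite J" "n < card J" "I = insert p J" "p \<notin> J"
      using Suc.prems p by (auto simp: J_def)
    obtain g where g: "\<exists>i\<in>J. g i \<noteq> 0"
      "\<forall>j<n. (\<Sum>i\<in>J. g i * (a j i - a j p * a n i / a n p)) = 0"
      using Suc.IH[of J "\<lambda>j i. a j i - a j p * a n i / a n p"] J by auto
    define s where "s = (\<Sum>i\<in>J. g i * a n i)"
    define h where "h = (\<lambda>i. if i = p then - s / a n p else g i)"
    have sum_h: "(\<Sum>i\<in>I. h i * a j i) = - s / a n p * a j p + (\<Sum>i\<in>J. g i * a j i)" for j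
    proof -
      have "(\<Sum>i\<in>J. h i * a j i) = (\<Sum>i\<in>J. g i * a j i)"
        using J(4) by (intro sum.cong) (auto simp: h_def)
      then show ?thesis using J by (simp add: h_def)
    qed
    have "(\<Sum>i\<in>I. h i * a j i) = 0" if "j < Suc n" for j
    proof (cases "j = n")
      case True
      then show ?thesis using p by (simp add: sum_h s_def)
    next
      case False
      then have "(\<Sum>i\<in>J. g i * (a j i - a j p * a n i / a n p)) = 0"
        using g that by auto
      moreover have "(\<Sum>i\<in>J. g i * (a j i - a j p * a n i / a n p))
          = (\<Sum>i\<in>J. g i * a j i) - a j p / a n p * s"
        unfolding s_def sum_distrib_left
        by (simp add: right_diff_distrib sum_subtractf mult_ac)
      ultimately show ?thesis by (simp add: sum_h)
    qed
    moreover have "\<exists>i\<in>I. h i \<noteq> 0" using g(1) J by (auto simp: h_def)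
    ultimately show ?thesis by blast
  qed
qed

text \<open>Take a point of the cube and the subspace with as many coordinates \<open>1\<close> or \<open>- 1\<close> as possible. If
  more than \<open>n\<close> coordinates were free, one could move in the subspace along these until one more hits
  the boundary.\<close>

lemma cube_subspace_vertex:
  fixes a :: "nat \<Rightarrow> nat \<Rightarrow> real"
  shows "\<exists>x. (\<forall>i. \<bar>x i\<bar> \<le> 1) \<and> (\<forall>j<n. (\<Sum>i<N. x i * a j i) = 0) \<and>
    N \<le> card {i\<in>{..<N}. \<bar>x i\<bar> = 1} + n"
proof -
  define K where "K = {x. (\<forall>i. \<bar>x i\<bar> \<le> 1) \<and> (\<forall>j<n. (\<Sum>i<N. x i * a j i) = 0)}"
  define c where "c x = card {i\<in>{..<N}. \<bar>x i\<bar> = 1}" for x :: "nat \<Rightarrow> real"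
  have c_le: "c x \<le> N" for x
    unfolding c_def using card_mono[of "{..<N}" "{i\<in>{..<N}. \<bar>x i\<bar> = 1}"] by auto
  have "(\<lambda>_. 0) \<in> K" by (simp add: K_def)
  then obtain x where x: "x \<in> K" and max: "\<And>y. y \<in> K \<Longrightarrow> c y \<le> c x"
    using ex_has_greatest_nat[of "\<lambda>x. x \<in> K" "\<lambda>_. 0" c "Suc N"] c_le
    by (auto simp: less_Suc_eq_le)
  define I where "I = {i\<in>{..<N}. \<bar>x i\<bar> \<noteq> 1}"
  have "{i\<in>{..<N}. \<bar>x i\<bar> = 1} \<union> I = {..<N}" by (auto simp: I_def)
  moreover have "card ({i\<in>{..<N}. \<bar>x i\<bar> = 1} \<union> I) = c x + card I"
    unfolding c_def by (rule card_Un_disjoint) (auto simp: I_def)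
  ultimately have card: "c x + card I = N" by simp
  have "card I \<le> n"
  proof (rule ccontr)
    assume "\<not> card I \<le> n"
    then obtain h where h: "\<exists>i\<in>I. h i \<noteq> 0" "\<forall>j<n. (\<Sum>i\<in>I. h i * a j i) = 0"
      using underdetermined_system[of I n a] by (auto simp: I_def)
    define J where "J = {i\<in>I. h i \<noteq> 0}"
    \<comment> \<open>\<open>r i\<close> is the time at which coordinate \<open>i\<close>, moving
      from \<open>x i\<close> with velocity \<open>h i\<close>, reaches the face
      \<open>sgn (h i)\<close>. The minimum \<open>t\<close> is the time of the first hit.\<close>
    define r where "r i = (1 - sgn (h i) * x i) / \<bar>h i\<bar>" for i
    define t where "t = Min (r ` J)"
    have J: "finite J" "J \<noteq> {}" using h(1) by (auto simp: J_def I_def)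
    have xle: "\<bar>x i\<bar> \<le> 1" for i using x by (auto simp: K_def)
    have xlt: "\<bar>x i\<bar> < 1" if "i \<in> I" for i
      using that xle[of i] by (auto simp: I_def)
    have t_in: "t \<in> r ` J" unfolding t_def using J by (intro Min_in) auto
    have t_le: "t \<le> r i" if "i \<in> J" for i unfolding t_def using J that by (intro Min_le) auto
    have r_pos: "0 < r i" if "i \<in> J" for i
      using that xlt[of i] by (auto simp: r_def J_def sgn_if abs_less_iff intro!: divide_pos_pos)
    have t_pos: "0 < t" using t_in r_pos by auto
    define y where "y i = x i + t * (if i \<in> I then h i else 0)" for i
    have y_le: "\<bar>y i\<bar> \<le> 1" for i
    proof (cases "i \<in> J")
      case True
      then have "t * \<bar>h i\<bar> \<le> 1 - sgn (h i) * x i"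
        using t_le[OF True] by (simp add: r_def J_def pos_le_divide_eq)
      moreover have "0 < t * \<bar>h i\<bar>" using True t_pos by (simp add: J_def)
      \<comment> \<open>The bound on \<open>t\<close> controls the face that coordinate
        \<open>i\<close> moves towards. The opposite face is not crossed because the coordinate
        starts strictly inside and moves away from it.\<close>
      ultimately show ?thesis using True xlt[of i]
        by (cases "h i > 0") (auto simp: y_def J_def sgn_if abs_le_iff abs_less_iff)
    next
      case False
      then have "y i = x i" by (auto simp: y_def J_def)
      then show ?thesis using xle by simp
    qed
    obtain p where p: "p \<in> J" "t = r p" using t_in by auto
    have "\<bar>y p\<bar> = 1"
      using p by (auto simp: y_def J_def r_def sgn_if abs_if)
    moreover have "y i = x i" if "i \<in> {..<N} - I" for i using that by (simp add: y_def)
    ultimately have "insert p {i\<in>{..<N}. \<bar>x i\<bar> = 1} \<subseteq> {i\<in>{..<N}. \<bar>y i\<bar> = 1}"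
      using p by (auto simp: J_def I_def)
    then have "card (insert p {i\<in>{..<N}. \<bar>x i\<bar> = 1}) \<le> c y"
      unfolding c_def by (intro card_mono) auto
    moreover have "p \<notin> {i\<in>{..<N}. \<bar>x i\<bar> = 1}" using p by (auto simp: J_def I_def)
    ultimately have "c x < c y" unfolding c_def by simp
    moreover have "y \<in> K"
    proof -
      have "(\<Sum>i<N. y i * a j i) = 0" if "j < n" for j
      proof -
        have "(\<Sum>i<N. (if i \<in> I then h i else 0) * a j i) = (\<Sum>i\<in>I. h i * a j i)"
          by (rule sum.mono_neutral_cong_right) (auto simp: I_def)
        moreover have "(\<Sum>i<N. y i * a j i)
            = (\<Sum>i<N. x i * a j i) + t * (\<Sum>i<N. (if i \<in> I then h i else 0) * a j i)"
          by (simp add: y_def distrib_right sum.distrib sum_distrib_left mult.assoc)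
        ultimately show ?thesis using x h(2) that by (simp add: K_def)
      qed
      then show ?thesis using y_le by (simp add: K_def)
    qed
    ultimately show False using max[of y] by simp
  qed
  then have "N \<le> c x + n" using card by simp
  then show ?thesis using x unfolding K_def c_def by blast
qed

section \<open>Monte Carlo averages\<close>

text \<open>The deviations \<open>z (\<omega> j)\<close> are independent with mean zero, so only the
  \<open>n\<close> diagonal terms of the squared sum survive integration. Each is at most 1, and
  division by the square of \<open>n\<close> leaves 1 / n.\<close>

lemma Monte_Carlo_mean_square_error:
  fixes h :: "'a \<Rightarrow> real"
  assumes U: "prob_space U" and h: "h \<in> borel_measurable U"
    and range: "\<And>u. 0 \<le> h u" "\<And>u. h u \<le> 1" and n: "0 < n"
  shows "(\<integral>\<^sup>+\<omega>. ennreal (((\<integral>u. h u \<partial>U) - (\<Sum>j<n. h (\<omega> j)) / real n)\<^sup>2) \<partial>Pi\<^sub>M {..<n} (\<lambda>_. U))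
    \<le> ennreal (1 / real n)"
proof -
  interpret U: prob_space U by fact
  interpret P: product_prob_space "\<lambda>_::nat. U" "{..<n}" by unfold_locales
  define P where "P = Pi\<^sub>M {..<n} (\<lambda>_::nat. U)"
  interpret PP: prob_space P unfolding P_def by unfold_locales
  define m where "m = (\<integral>u. h u \<partial>U)"
  define z where "z u = m - h u" for u
  have h_int: "integrable U h"
    using h range by (intro U.integrable_const_bound[where B = 1]) auto
  have m: "0 \<le> m" "m \<le> 1"
    unfolding m_def using range h_int
    by (auto intro!: integral_nonneg_AE U.integral_le_const)
  have z_le: "\<bar>z u\<bar> \<le> 1" for u using m range[of u] by (auto simp: z_def abs_le_iff)
  have z_meas[measurable]: "z \<in> borel_measurable U" unfolding z_def using h by simp
  have z_int: "integrable U z" unfolding z_def using h_int by simp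
  have z_mean: "(\<integral>u. z u \<partial>U) = 0"
    unfolding z_def using h_int by (simp add: m_def U.prob_space)
  have comp: "(\<lambda>\<omega>. z (\<omega> i)) \<in> borel_measurable P" if "i < n" for i
    unfolding P_def using that z_meas
    by (intro measurable_compose[OF measurable_component_singleton]) auto
  have zz_int: "integrable P (\<lambda>\<omega>. z (\<omega> i) * z (\<omega> j))" if "i < n" "j < n" for i j
    using that comp z_le
    by (intro PP.integrable_const_bound[where B = 1])
      (auto simp: abs_mult intro!: mult_le_one)
  have cross: "(\<integral>\<omega>. z (\<omega> i) * z (\<omega> j) \<partial>P) = 0" if "i < n" "j < n" "i \<noteq> j" for i j
  proof -
    \<comment> \<open>Padding with the constant 1 writes the mixed term as a product with one factor
      per coordinate, to which the product formula for integrals applies.\<close>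
    define g where "g k = (if k = i \<or> k = j then z else (\<lambda>_. 1))" for k
    have prod_g: "(\<Prod>k<n. g k (\<omega> k)) = z (\<omega> i) * z (\<omega> j)" for \<omega> :: "nat \<Rightarrow> 'a"
    proof -
      have "(\<Prod>k<n. g k (\<omega> k)) = (\<Prod>k\<in>{i, j}. g k (\<omega> k))"
        using that by (intro prod.mono_neutral_right) (auto simp: g_def)
      then show ?thesis using that by (simp add: g_def)
    qed
    have "(\<integral>\<omega>. (\<Prod>k<n. g k (\<omega> k)) \<partial>P) = (\<Prod>k<n. integral\<^sup>L U (g k))"
      unfolding P_def using z_int by (intro P.product_integral_prod) (auto simp: g_def)
    also have "\<dots> = 0"
      using that z_mean by (intro prod_zero) (auto simp: g_def intro!: bexI[of _ i])
    finally show ?thesis by (simp add: prod_g)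
  qed
  have expand: "(m - (\<Sum>j<n. h (\<omega> j)) / real n)\<^sup>2
      = (\<Sum>i<n. \<Sum>j<n. z (\<omega> i) * z (\<omega> j)) / (real n)\<^sup>2" for \<omega>
  proof -
    have "m - (\<Sum>j<n. h (\<omega> j)) / real n = (\<Sum>j<n. z (\<omega> j)) / real n"
      using n by (simp add: z_def sum_subtractf field_simps)
    then show ?thesis by (simp add: power_divide power2_eq_square sum_product)
  qed
  have "(\<integral>\<omega>. (\<Sum>i<n. \<Sum>j<n. z (\<omega> i) * z (\<omega> j)) \<partial>P)
      = (\<Sum>i<n. \<integral>\<omega>. (\<Sum>j<n. z (\<omega> i) * z (\<omega> j)) \<partial>P)"
    using zz_int by (intro Bochner_Integration.integral_sum Bochner_Integration.integrable_sum) auto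
  also have "\<dots> = (\<Sum>i<n. \<Sum>j<n. \<integral>\<omega>. z (\<omega> i) * z (\<omega> j) \<partial>P)"
    using zz_int by (intro sum.cong refl Bochner_Integration.integral_sum) auto
  finally have sums: "(\<integral>\<omega>. (m - (\<Sum>j<n. h (\<omega> j)) / real n)\<^sup>2 \<partial>P)
      = (\<Sum>i<n. \<Sum>j<n. \<integral>\<omega>. z (\<omega> i) * z (\<omega> j) \<partial>P) / (real n)\<^sup>2"
    by (simp only: expand integral_divide_zero)
  have "(\<Sum>i<n. \<Sum>j<n. \<integral>\<omega>. z (\<omega> i) * z (\<omega> j) \<partial>P) = (\<Sum>i<n. \<integral>\<omega>. z (\<omega> i) * z (\<omega> i) \<partial>P)"
  proof (rule sum.cong[OF refl])
    fix i assume i: "i \<in> {..<n}"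
    have "(\<Sum>j<n. \<integral>\<omega>. z (\<omega> i) * z (\<omega> j) \<partial>P) = (\<Sum>j\<in>{i}. \<integral>\<omega>. z (\<omega> i) * z (\<omega> j) \<partial>P)"
      using i cross by (intro sum.mono_neutral_right) auto
    then show "(\<Sum>j<n. \<integral>\<omega>. z (\<omega> i) * z (\<omega> j) \<partial>P) = (\<integral>\<omega>. z (\<omega> i) * z (\<omega> i) \<partial>P)"
      by simp
  qed
  also have "\<dots> \<le> (\<Sum>i<n. 1)"
  proof (intro sum_mono PP.integral_le_const AE_I2)
    fix i \<omega> assume "i \<in> {..<n}"
    show "z (\<omega> i) * z (\<omega> i) \<le> 1"
      using z_le[of "\<omega> i"] by (metis abs_le_square_iff abs_one one_power2 power2_eq_square)
  qed (use zz_int in auto)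
  finally have "(\<Sum>i<n. \<Sum>j<n. \<integral>\<omega>. z (\<omega> i) * z (\<omega> j) \<partial>P) / (real n)\<^sup>2 \<le> real n / (real n)\<^sup>2"
    by (intro divide_right_mono) auto
  moreover have "real n / (real n)\<^sup>2 = 1 / real n" by (simp add: power2_eq_square)
  ultimately have le: "(\<integral>\<omega>. (m - (\<Sum>j<n. h (\<omega> j)) / real n)\<^sup>2 \<partial>P) \<le> 1 / real n"
    unfolding sums by simp
  have "integrable P (\<lambda>\<omega>. (m - (\<Sum>j<n. h (\<omega> j)) / real n)\<^sup>2)"
    unfolding expand using zz_int by (intro integrable_divide Bochner_Integration.integrable_sum) auto
  then have "(\<integral>\<^sup>+\<omega>. ennreal ((m - (\<Sum>j<n. h (\<omega> j)) / real n)\<^sup>2) \<partial>P)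
      = ennreal (\<integral>\<omega>. (m - (\<Sum>j<n. h (\<omega> j)) / real n)\<^sup>2 \<partial>P)"
    by (intro nn_integral_eq_integral) auto
  then show ?thesis using le by (simp add: P_def m_def ennreal_leI)
qed

section \<open>The spaces and the operator\<close>

text \<open>An element \<open>f\<close> of the domain represents the function \<open>u \<mapsto> point_value u f\<close> of a real variable,
  \<open>f (prod_encode (k, m))\<close> being its approximate value at \<open>m / 2 ^ k\<close>. This makes all point values
  measurable functions of \<open>u\<close> and continuous functionals of \<open>f\<close>.\<close>

definition dyadic_index :: "nat \<Rightarrow> real \<Rightarrow> nat" where
  "dyadic_index k u = prod_encode (k, nat \<lfloor>2 ^ k * u\<rfloor>)"

definition point_value :: "real \<Rightarrow> (nat \<Rightarrow> real) \<Rightarrow> real" where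
  "point_value u f = lim (\<lambda>k. f (dyadic_index k u))"

text \<open>The supremum runs over entries rather than point values. Distinct sequences may
  represent the same function, so point values would give only a seminorm; moreover each entry
  becomes a nonexpansive function of \<open>f\<close>.\<close>

definition sup_norm :: "(nat \<Rightarrow> real) \<Rightarrow> real" where
  "sup_norm f = (SUP n. \<bar>f n\<bar>)"

text \<open>Convergence is required at every real \<open>u\<close>, also outside the unit interval:
  \<open>unit_uniform\<close> lives on the whole line, and every sample, not just almost every one,
  has to yield a linear functional.\<close>

definition dyadic_functions :: "(nat \<Rightarrow> real) set" where
  "dyadic_functions =
    {f. (\<exists>B. \<forall>n. \<bar>f n\<bar> \<le> B) \<and> (\<forall>u. convergent (\<lambda>k. f (dyadic_index k u)))}"

definition dyadic_space :: "(nat \<Rightarrow> real) nspace" where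
  "dyadic_space = \<lparr>carr = dyadic_functions, vzero = (\<lambda>_. 0), vadd = (\<lambda>f g n. f n + g n),
    vscale = (\<lambda>a f n. a * f n), vnorm = sup_norm\<rparr>"

text \<open>An isometric copy of the real line on the type of sequences.\<close>

definition constants_space :: "(nat \<Rightarrow> real) nspace" where
  "constants_space = \<lparr>carr = range (\<lambda>r _. r), vzero = (\<lambda>_. 0), vadd = (\<lambda>f g n. f n + g n),
    vscale = (\<lambda>a f n. a * f n), vnorm = (\<lambda>f. \<bar>f 0\<bar>)\<rparr>"

definition unit_uniform :: "real measure" where
  "unit_uniform = uniform_measure lborel {0..1}"

definition mean_abs :: "(nat \<Rightarrow> real) \<Rightarrow> real" where
  "mean_abs f = (\<integral>u. \<bar>point_value u f\<bar> \<partial>unit_uniform)"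

definition mean_abs_op :: "(nat \<Rightarrow> real) \<Rightarrow> nat \<Rightarrow> real" where
  "mean_abs_op f = (\<lambda>_. mean_abs f)"

lemma dyadic_space_simps [simp]:
  "carr dyadic_space = dyadic_functions" "vzero dyadic_space = (\<lambda>_. 0)"
  "vadd dyadic_space f g = (\<lambda>n. f n + g n)" "vscale dyadic_space a f = (\<lambda>n. a * f n)"
  "vnorm dyadic_space = sup_norm" "vdiff dyadic_space f g = (\<lambda>n. f n - g n)"
  by (simp_all add: dyadic_space_def vdiff_def)

lemma constants_space_simps [simp]:
  "carr constants_space = range (\<lambda>r _. r)" "vzero constants_space = (\<lambda>_. 0)"
  "vadd constants_space f g = (\<lambda>n. f n + g n)" "vscale constants_space a f = (\<lambda>n. a * f n)"
  "vnorm constants_space f = \<bar>f 0\<bar>" "vdiff constants_space f g = (\<lambda>n. f n - g n)"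
  by (simp_all add: constants_space_def vdiff_def)

lemma type_nspace_simps [simp]:
  "carr type_nspace = UNIV" "vadd type_nspace = (+)" "vscale type_nspace = scaleR"
  "vnorm type_nspace = norm" "vdiff type_nspace x y = x - y"
  by (simp_all add: type_nspace_def vdiff_def)

section \<open>Vector space structure and norm of the domain\<close>

lemma dyadic_functions_zero: "(\<lambda>_. 0) \<in> dyadic_functions"
  by (auto simp: dyadic_functions_def convergent_const intro: exI[of _ 0])

lemma dyadic_functions_add:
  assumes "f \<in> dyadic_functions" "g \<in> dyadic_functions"
  shows "(\<lambda>n. f n + g n) \<in> dyadic_functions"
proof -
  obtain A B where "\<forall>n. \<bar>f n\<bar> \<le> A" "\<forall>n. \<bar>g n\<bar> \<le> B"
    using assms by (auto simp: dyadic_functions_def)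
  then have "\<bar>f n + g n\<bar> \<le> A + B" for n by (meson abs_triangle_ineq add_mono order_trans)
  then show ?thesis using assms by (auto simp: dyadic_functions_def intro!: convergent_add)
qed

lemma dyadic_functions_scale:
  assumes "f \<in> dyadic_functions"
  shows "(\<lambda>n. a * f n) \<in> dyadic_functions"
proof -
  obtain B where "\<forall>n. \<bar>f n\<bar> \<le> B" using assms by (auto simp: dyadic_functions_def)
  then have "\<bar>a * f n\<bar> \<le> \<bar>a\<bar> * B" for n by (simp add: abs_mult mult_left_mono)
  then show ?thesis using assms by (auto simp: dyadic_functions_def intro!: convergent_mult convergent_const)
qed

lemma dyadic_functions_diff:
  assumes "f \<in> dyadic_functions" "g \<in> dyadic_functions"
  shows "(\<lambda>n. f n - g n) \<in> dyadic_functions"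
  using dyadic_functions_add[OF assms(1) dyadic_functions_scale[OF assms(2), of "- 1"]] by simp

lemma abs_le_sup_norm: "f \<in> dyadic_functions \<Longrightarrow> \<bar>f n\<bar> \<le> sup_norm f"
  unfolding sup_norm_def
  by (rule cSUP_upper) (auto simp: dyadic_functions_def bdd_above_def)

lemma sup_norm_le: "(\<And>n. \<bar>f n\<bar> \<le> B) \<Longrightarrow> sup_norm f \<le> B"
  unfolding sup_norm_def by (rule cSUP_least) auto

lemma sup_norm_nonneg: "f \<in> dyadic_functions \<Longrightarrow> 0 \<le> sup_norm f"
  using abs_le_sup_norm[of f 0] by linarith

lemma sup_norm_scale:
  assumes "f \<in> dyadic_functions"
  shows "sup_norm (\<lambda>n. a * f n) = \<bar>a\<bar> * sup_norm f"
proof (rule antisym)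
  show "sup_norm (\<lambda>n. a * f n) \<le> \<bar>a\<bar> * sup_norm f"
    using abs_le_sup_norm[OF assms] by (intro sup_norm_le) (simp add: abs_mult mult_left_mono)
  show "\<bar>a\<bar> * sup_norm f \<le> sup_norm (\<lambda>n. a * f n)"
  proof (cases "a = 0")
    case True
    then show ?thesis by (simp add: sup_norm_def)
  next
    case False
    have "\<bar>f n\<bar> \<le> sup_norm (\<lambda>n. a * f n) / \<bar>a\<bar>" for n
      using abs_le_sup_norm[OF dyadic_functions_scale[OF assms, of a], of n] False
      by (simp add: abs_mult pos_le_divide_eq mult.commute)
    then have "sup_norm f \<le> sup_norm (\<lambda>n. a * f n) / \<bar>a\<bar>" by (rule sup_norm_le)
    then show ?thesis using False by (simp add: pos_le_divide_eq mult.commute)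
  qed
qed

lemma real_normed_space_dyadic: "real_normed_space dyadic_space"
proof
  fix f g :: "nat \<Rightarrow> real" assume "f \<in> carr dyadic_space"
  then have f: "f \<in> dyadic_functions" by simp
  have "f = (\<lambda>_. 0)" if "sup_norm f = 0"
    using abs_le_sup_norm[OF f] that by auto
  then show "(vnorm dyadic_space f = 0) = (f = vzero dyadic_space)"
    by (auto simp: sup_norm_def)
  assume "g \<in> carr dyadic_space"
  then have g: "g \<in> dyadic_functions" by simp
  have "\<bar>f n + g n\<bar> \<le> sup_norm f + sup_norm g" for n
    using abs_le_sup_norm[OF f, of n] abs_le_sup_norm[OF g, of n] by linarith
  then show "vnorm dyadic_space (vadd dyadic_space f g) \<le> vnorm dyadic_space f + vnorm dyadic_space g"
    by (auto intro: sup_norm_le)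
qed (auto simp: dyadic_functions_zero dyadic_functions_add dyadic_functions_scale
  sup_norm_nonneg sup_norm_scale algebra_simps)

lemma real_normed_space_constants: "real_normed_space constants_space"
  by unfold_locales (auto simp: algebra_simps abs_mult abs_triangle_ineq fun_eq_iff image_iff)

section \<open>Point values as continuous linear functionals\<close>

lemma point_value_tendsto:
  "f \<in> dyadic_functions \<Longrightarrow> (\<lambda>k. f (dyadic_index k u)) \<longlonglongrightarrow> point_value u f"
  by (auto simp: dyadic_functions_def point_value_def convergent_LIMSEQ_iff)

lemma point_value_add:
  assumes "f \<in> dyadic_functions" "g \<in> dyadic_functions"
  shows "point_value u (\<lambda>n. f n + g n) = point_value u f + point_value u g"
  unfolding point_value_def[of _ "\<lambda>n. f n + g n"]
  by (intro limI tendsto_add point_value_tendsto assms)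

lemma point_value_scale:
  assumes "f \<in> dyadic_functions"
  shows "point_value u (\<lambda>n. a * f n) = a * point_value u f"
  unfolding point_value_def[of _ "\<lambda>n. a * f n"]
  by (intro limI tendsto_mult tendsto_const point_value_tendsto assms)

lemma abs_point_value_le:
  assumes "f \<in> dyadic_functions"
  shows "\<bar>point_value u f\<bar> \<le> sup_norm f"
  using tendsto_rabs[OF point_value_tendsto[OF assms]]
  by (rule LIMSEQ_le_const2) (auto simp: abs_le_sup_norm[OF assms])

lemma point_value_diff:
  assumes "f \<in> dyadic_functions" "g \<in> dyadic_functions"
  shows "point_value u (\<lambda>n. f n - g n) = point_value u f - point_value u g"
  using point_value_add[OF assms(1) dyadic_functions_scale[OF assms(2), of "- 1"]]
    point_value_scale[OF assms(2), of u "- 1"] by simp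

lemma point_value_continuous_linear:
  "point_value u \<in> continuous_linear_functionals dyadic_space"
proof -
  have "continuous_map (ntop dyadic_space) (ntop type_nspace) (point_value u)"
    by (intro nonexpansive_continuous_map real_normed_space_dyadic real_normed_space_type)
      (auto simp: point_value_diff[symmetric] dyadic_functions_diff abs_point_value_le)
  then show ?thesis
    by (simp add: continuous_linear_functionals_def linear_functionals_def linear_operator_def
        ntop_type point_value_add point_value_scale)
qed

section \<open>Measurability of entries and point values\<close>

lemma coordinate_measurable: "(\<lambda>f. f n) \<in> borel_measurable (nborel dyadic_space)"
proof -
  have "\<bar>f n - g n\<bar> \<le> sup_norm (\<lambda>n. f n - g n)"
    if "f \<in> dyadic_functions" "g \<in> dyadic_functions" for f g
    using abs_le_sup_norm[OF dyadic_functions_diff[OF that], of n] .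
  then have "continuous_map (ntop dyadic_space) (ntop type_nspace) (\<lambda>f. f n)"
    by (intro nonexpansive_continuous_map real_normed_space_dyadic real_normed_space_type) auto
  then show ?thesis
    using continuous_map_measurable_nborel[OF real_normed_space_dyadic real_normed_space_type]
    by (simp add: nborel_type)
qed

lemma constants_measurable: "(\<lambda>r _. r) \<in> measurable borel (nborel constants_space)"
proof -
  have "continuous_map (ntop type_nspace) (ntop constants_space) (\<lambda>r::real. \<lambda>_. r)"
    by (intro nonexpansive_continuous_map real_normed_space_constants real_normed_space_type) auto
  then show ?thesis
    using continuous_map_measurable_nborel[OF real_normed_space_type real_normed_space_constants]
    by (simp add: nborel_type)
qed

lemma dyadic_index_measurable: "dyadic_index k \<in> measurable borel (count_space UNIV)"
  unfolding dyadic_index_def by measurable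

text \<open>At each level \<open>k\<close> the index takes countably many values, so the map splits
  into countably many measurable pieces, on each of which a fixed entry of \<open>f\<close> is read.
  Entries are Borel functions of \<open>f\<close>, and the limit in \<open>k\<close> preserves
  measurability.\<close>

lemma point_value_measurable2:
  assumes u: "u \<in> borel_measurable M"
  shows "(\<lambda>(f, \<omega>). point_value (u \<omega>) f) \<in> borel_measurable (nborel dyadic_space \<Otimes>\<^sub>M M)"
proof -
  have "(\<lambda>x. fst x (dyadic_index k (u (snd x)))) \<in> borel_measurable (nborel dyadic_space \<Otimes>\<^sub>M M)" for k
  proof (rule measurable_compose_countable)
    show "(\<lambda>x. fst x i) \<in> borel_measurable (nborel dyadic_space \<Otimes>\<^sub>M M)" for i
      by (rule measurable_compose[OF measurable_fst coordinate_measurable])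
    show "(\<lambda>x. dyadic_index k (u (snd x))) \<in> measurable (nborel dyadic_space \<Otimes>\<^sub>M M) (count_space UNIV)"
      by (rule measurable_compose[OF measurable_compose[OF measurable_snd u] dyadic_index_measurable])
  qed
  then show ?thesis
    unfolding point_value_def case_prod_beta by (rule borel_measurable_lim_metric)
qed

lemma point_value_measurable: "(\<lambda>u. point_value u f) \<in> borel_measurable unit_uniform"
proof -
  have "(\<lambda>u. f (dyadic_index k u)) \<in> borel_measurable borel" for k
    by (rule measurable_compose[OF dyadic_index_measurable]) simp
  then have "(\<lambda>u. point_value u f) \<in> borel_measurable borel"
    unfolding point_value_def by (rule borel_measurable_lim_metric)
  then show ?thesis by (simp add: unit_uniform_def cong: measurable_cong_sets)
qed

section \<open>The mean absolute value as a nonexpansive operator\<close>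

lemma prob_space_unit_uniform: "prob_space unit_uniform"
  unfolding unit_uniform_def by (rule prob_space_uniform_measure) auto

lemma integrable_abs_point_value:
  assumes "f \<in> dyadic_functions"
  shows "integrable unit_uniform (\<lambda>u. \<bar>point_value u f\<bar>)"
proof -
  interpret prob_space unit_uniform by (rule prob_space_unit_uniform)
  show ?thesis using abs_point_value_le[OF assms] point_value_measurable
    by (intro integrable_const_bound[where B = "sup_norm f"]) auto
qed

lemma mean_abs_bounds:
  assumes "f \<in> dyadic_functions"
  shows "0 \<le> mean_abs f" "mean_abs f \<le> sup_norm f"
proof -
  interpret prob_space unit_uniform by (rule prob_space_unit_uniform)
  show "0 \<le> mean_abs f" unfolding mean_abs_def by simp
  show "mean_abs f \<le> sup_norm f"
    unfolding mean_abs_def using abs_point_value_le[OF assms] integrable_abs_point_value[OF assms]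
    by (intro integral_le_const) auto
qed

lemma mean_abs_zero: "mean_abs (\<lambda>_. 0) = 0"
  by (simp add: mean_abs_def point_value_def)

lemma mean_abs_nonexpansive:
  assumes f: "f \<in> dyadic_functions" and g: "g \<in> dyadic_functions"
  shows "\<bar>mean_abs f - mean_abs g\<bar> \<le> sup_norm (\<lambda>n. f n - g n)"
proof -
  interpret prob_space unit_uniform by (rule prob_space_unit_uniform)
  have le: "\<bar>\<bar>point_value u f\<bar> - \<bar>point_value u g\<bar>\<bar> \<le> sup_norm (\<lambda>n. f n - g n)" for u
    using abs_point_value_le[OF dyadic_functions_diff[OF f g], of u] abs_triangle_ineq3
    unfolding point_value_diff[OF f g] by (rule order_trans[rotated])
  have "mean_abs f - mean_abs g = (\<integral>u. \<bar>point_value u f\<bar> - \<bar>point_value u g\<bar> \<partial>unit_uniform)"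
    unfolding mean_abs_def using f g by (simp add: integrable_abs_point_value)
  also have "\<bar>\<dots>\<bar> \<le> (\<integral>u. \<bar>\<bar>point_value u f\<bar> - \<bar>point_value u g\<bar>\<bar> \<partial>unit_uniform)"
    by (rule integral_abs_bound)
  also have "\<dots> \<le> sup_norm (\<lambda>n. f n - g n)"
    using le f g by (intro integral_le_const) (auto simp: integrable_abs_point_value)
  finally show ?thesis .
qed

lemma mean_abs_op_continuous:
  "continuous_map (ntop dyadic_space) (ntop constants_space) mean_abs_op"
  by (intro nonexpansive_continuous_map real_normed_space_dyadic real_normed_space_constants)
    (auto simp: mean_abs_op_def mean_abs_nonexpansive)

section \<open>Dyadic step functions\<close>

text \<open>On nonnegative reals this encodes the indicator of the interval from
  \<open>i / 2 ^ p\<close> to \<open>(i + 1) / 2 ^ p\<close>, closed on the left and open on the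
  right. Entries of levels below \<open>p\<close> are too coarse to decide membership and are set to
  0, which does not affect the limits.\<close>

definition dyadic_step :: "nat \<Rightarrow> nat \<Rightarrow> nat \<Rightarrow> real" where
  "dyadic_step p i n = (case prod_decode n of (k, m) \<Rightarrow> if p \<le> k \<and> m div 2 ^ (k - p) = i then 1 else 0)"

definition step_sum :: "nat \<Rightarrow> (nat \<Rightarrow> real) \<Rightarrow> nat \<Rightarrow> real" where
  "step_sum p x n = (\<Sum>i<2 ^ p. x i * dyadic_step p i n)"

text \<open>Dropping the last \<open>k - p\<close> binary digits of the index at level
  \<open>k\<close> gives the index at level \<open>p\<close>. Hence the approximations of a level
  \<open>p\<close> step function are constant from level \<open>p\<close> on.\<close>

lemma nat_floor_dyadic_div:
  assumes "p \<le> k"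
  shows "nat \<lfloor>2 ^ k * u\<rfloor> div 2 ^ (k - p) = nat \<lfloor>2 ^ p * (u::real)\<rfloor>"
proof -
  have "\<lfloor>2 ^ k * u\<rfloor> div 2 ^ (k - p) = \<lfloor>2 ^ k * u / real_of_int (2 ^ (k - p))\<rfloor>"
    by (rule floor_divide_real_eq_div[symmetric]) simp
  also have "2 ^ k * u / real_of_int (2 ^ (k - p)) = 2 ^ p * u"
    using assms by (simp add: field_simps flip: power_add)
  finally have "nat (\<lfloor>2 ^ k * u\<rfloor> div 2 ^ (k - p)) = nat \<lfloor>2 ^ p * u\<rfloor>" by simp
  then show ?thesis by (simp add: nat_div_distrib' nat_power_eq)
qed

lemma dyadic_step_tendsto:
  "(\<lambda>k. dyadic_step p i (dyadic_index k u)) \<longlonglongrightarrow> (if nat \<lfloor>2 ^ p * u\<rfloor> = i then 1 else 0)"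
proof (rule tendsto_eventually)
  show "\<forall>\<^sub>F k in sequentially. dyadic_step p i (dyadic_index k u) = (if nat \<lfloor>2 ^ p * u\<rfloor> = i then 1 else 0)"
    using eventually_ge_at_top[of p]
    by eventually_elim (auto simp: dyadic_step_def dyadic_index_def nat_floor_dyadic_div)
qed

lemma dyadic_step_in: "dyadic_step p i \<in> dyadic_functions"
proof -
  have "\<bar>dyadic_step p i n\<bar> \<le> 1" for n by (simp add: dyadic_step_def split: prod.split)
  moreover have "convergent (\<lambda>k. dyadic_step p i (dyadic_index k u))" for u
    using dyadic_step_tendsto by (rule convergentI)
  ultimately show ?thesis by (auto simp: dyadic_functions_def)
qed

lemma dyadic_functions_sum:
  assumes "finite I" "\<And>i. i \<in> I \<Longrightarrow> b i \<in> dyadic_functions"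
  shows "(\<lambda>n. \<Sum>i\<in>I. x i * b i n) \<in> dyadic_functions"
  using assms
  by (induction I rule: finite_induct)
    (auto simp: dyadic_functions_zero intro!: dyadic_functions_add dyadic_functions_scale)

lemma linear_functional_zero:
  assumes "T \<in> linear_functionals dyadic_space"
  shows "T (\<lambda>_. 0) = 0"
proof -
  have "\<forall>a. \<forall>f\<in>dyadic_functions. T (\<lambda>n. a * f n) = a * T f"
    using assms by (simp add: linear_functionals_def linear_operator_def)
  from spec[OF this, of 0] dyadic_functions_zero show ?thesis by force
qed

lemma linear_functional_sum:
  assumes T: "T \<in> linear_functionals dyadic_space"
    and "finite I" "\<And>i. i \<in> I \<Longrightarrow> b i \<in> dyadic_functions"
  shows "T (\<lambda>n. \<Sum>i\<in>I. x i * b i n) = (\<Sum>i\<in>I. x i * T (b i))"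
  using assms(2,3)
proof (induction I rule: finite_induct)
  case empty
  then show ?case using linear_functional_zero[OF T] by simp
next
  case (insert j I)
  have "T (\<lambda>n. x j * b j n + (\<Sum>i\<in>I. x i * b i n)) = T (\<lambda>n. x j * b j n) + T (\<lambda>n. \<Sum>i\<in>I. x i * b i n)"
    using T insert.prems dyadic_functions_sum[OF insert.hyps(1), of b x]
      dyadic_functions_scale[of "b j" "x j"]
    by (auto simp: linear_functionals_def linear_operator_def)
  also have "T (\<lambda>n. x j * b j n) = x j * T (b j)"
    using T insert.prems by (auto simp: linear_functionals_def linear_operator_def)
  finally show ?case using insert by simp
qed

lemma step_sum_in: "step_sum p x \<in> dyadic_functions"
  unfolding step_sum_def[abs_def] by (intro dyadic_functions_sum dyadic_step_in) auto

text \<open>Intervals of one level are disjoint, so every entry of the sum is a single coefficient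
  or 0.\<close>

lemma sup_norm_step_sum:
  assumes "\<And>i. \<bar>x i\<bar> \<le> 1"
  shows "sup_norm (step_sum p x) \<le> 1"
proof (rule sup_norm_le)
  fix n
  obtain k m where "prod_decode n = (k, m)" by (cases "prod_decode n")
  then have "step_sum p x n
      = (\<Sum>i<2 ^ p. if i = m div 2 ^ (k - p) then (if p \<le> k then x i else 0) else 0)"
    unfolding step_sum_def dyadic_step_def by (intro sum.cong) auto
  also have "\<dots> = (if m div 2 ^ (k - p) < 2 ^ p \<and> p \<le> k then x (m div 2 ^ (k - p)) else 0)"
    by simp
  finally show "\<bar>step_sum p x n\<bar> \<le> 1" using assms by simp
qed

lemma point_value_step_sum:
  "point_value u (step_sum p x) = (\<Sum>i<2 ^ p. x i * (if nat \<lfloor>2 ^ p * u\<rfloor> = i then 1 else 0))"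
  unfolding point_value_def step_sum_def[abs_def]
  by (intro limI tendsto_sum tendsto_mult tendsto_const dyadic_step_tendsto)

lemma measure_unit_uniform_dyadic:
  assumes "i < 2 ^ p"
  shows "measure unit_uniform {real i / 2 ^ p..<(real i + 1) / 2 ^ p} = 1 / 2 ^ p"
proof -
  have "real i + 1 \<le> 2 ^ p"
    using of_nat_mono[OF Suc_leI[OF assms], where 'a = real] by simp
  then have "(real i + 1) / 2 ^ p \<le> 1" by (simp add: divide_le_eq)
  then have "{0..1} \<inter> {real i / 2 ^ p..<(real i + 1) / 2 ^ p} = {real i / 2 ^ p..<(real i + 1) / 2 ^ p}"
    by (intro Int_absorb1) (auto simp: atLeastLessThan_subseteq_atLeastAtMost_iff)
  moreover have "real i / 2 ^ p \<le> (real i + 1) / 2 ^ p" by (simp add: divide_right_mono)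
  ultimately show ?thesis
    by (simp add: unit_uniform_def diff_divide_distrib[symmetric])
qed

text \<open>An inequality avoids discussing the rest of the line: off the intervals the sum of
  indicators is 0, which lies below any absolute value, and on them the two integrands
  agree.\<close>

lemma mean_abs_step_sum: "(\<Sum>i<2 ^ p. \<bar>x i\<bar>) / 2 ^ p \<le> mean_abs (step_sum p x)"
proof -
  interpret prob_space unit_uniform by (rule prob_space_unit_uniform)
  define D where "D i = {real i / 2 ^ p..<(real i + 1) / 2 ^ p}" for i :: nat
  have floor: "nat \<lfloor>2 ^ p * u\<rfloor> = i" if "u \<in> D i" for u i
  proof -
    have "real i \<le> 2 ^ p * u" "2 ^ p * u < real i + 1"
      using that by (simp_all add: D_def divide_le_eq less_divide_eq mult.commute)
    then have "\<lfloor>2 ^ p * u\<rfloor> = int i" by (simp add: floor_eq_iff)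
    then show ?thesis by simp
  qed
  have sets: "D i \<in> sets unit_uniform" for i by (simp add: D_def unit_uniform_def)
  have int: "integrable unit_uniform (\<lambda>u. \<bar>x i\<bar> * indicator (D i) u)" for i
    using sets by (intro integrable_mult_right integrable_real_indicator) (auto simp: emeasure_eq_measure)
  have "(\<Sum>i<2 ^ p. \<bar>x i\<bar>) / 2 ^ p = (\<Sum>i<2 ^ p. \<bar>x i\<bar> * measure unit_uniform (D i))"
    unfolding D_def by (simp add: measure_unit_uniform_dyadic sum_divide_distrib)
  also have "\<dots> = (\<integral>u. (\<Sum>i<2 ^ p. \<bar>x i\<bar> * indicator (D i) u) \<partial>unit_uniform)"
    using int sets
    by (subst Bochner_Integration.integral_sum) (auto simp: emeasure_eq_measure)
  also have "\<dots> \<le> mean_abs (step_sum p x)"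
    unfolding mean_abs_def
  proof (intro integral_mono Bochner_Integration.integrable_sum int
      integrable_abs_point_value step_sum_in)
    fix u
    show "(\<Sum>i<2 ^ p. \<bar>x i\<bar> * indicator (D i) u) \<le> \<bar>point_value u (step_sum p x)\<bar>"
    proof (cases "\<exists>j<2 ^ p. u \<in> D j")
      case True
      then obtain j where j: "j < 2 ^ p" "u \<in> D j" by auto
      have "(\<Sum>i<2 ^ p. \<bar>x i\<bar> * indicator (D i) u) = (\<Sum>i<2 ^ p. if i = j then \<bar>x i\<bar> else 0)"
        using j floor[of u] by (intro sum.cong) (auto simp: indicator_def)
      moreover have "point_value u (step_sum p x) = (\<Sum>i<2 ^ p. if i = j then x i else 0)"
        unfolding point_value_step_sum floor[OF j(2)] by (intro sum.cong) auto
      ultimately show ?thesis using j(1) by simp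
    next
      case False
      then have "(\<Sum>i<2 ^ p. \<bar>x i\<bar> * indicator (D i) u) = 0" by (intro sum.neutral) auto
      then show ?thesis by simp
    qed
  qed
  finally show ?thesis .
qed

section \<open>Worst case error\<close>

lemma length_info [simp]: "length (info L f k) = k"
  by (induction k) auto

text \<open>This disposes of adaptivity. Along zero answers the rule commits to the functionals
  \<open>L (replicate j 0)\<close>, a fixed finite list, and every \<open>f\<close> in their common
  kernel produces the same data as the zero function.\<close>

lemma info_replicate_zero:
  assumes "\<And>j. j < n \<Longrightarrow> L (replicate j 0) f = 0" "k \<le> n"
  shows "info L f k = replicate k 0"
  using assms(2) by (induction k) (use assms(1) in \<open>auto simp: replicate_append_same\<close>)

lemma mean_abs_scale:
  assumes "f \<in> dyadic_functions"
  shows "mean_abs (\<lambda>n. a * f n) = \<bar>a\<bar> * mean_abs f"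
  by (simp add: mean_abs_def point_value_scale[OF assms] abs_mult)

text \<open>The cube lemma is applied to the matrix of values \<open>T j (dyadic_step p i)\<close>.
  At least \<open>2 ^ p - n\<close> coefficients have modulus 1, so their mean modulus is at least
  \<open>1 - n / 2 ^ p\<close>. The factor \<open>r\<close> serves to move the function into the
  open unit ball.\<close>

lemma kernel_large_mean_abs:
  assumes T: "\<And>j. j < n \<Longrightarrow> T j \<in> linear_functionals dyadic_space" and r: "0 \<le> r"
  shows "\<exists>f\<in>dyadic_functions. sup_norm f \<le> r \<and> (\<forall>j<n. T j f = 0) \<and>
    r * (1 - real n / 2 ^ p) \<le> mean_abs f"
proof -
  obtain x where x: "\<And>i. \<bar>x i\<bar> \<le> 1"
    "\<forall>j<n. (\<Sum>i<2 ^ p. x i * T j (dyadic_step p i)) = 0"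
    "2 ^ p \<le> card {i\<in>{..<2 ^ p}. \<bar>x i\<bar> = 1} + n"
    using cube_subspace_vertex[where N = "2 ^ p" and n = n and a = "\<lambda>j i. T j (dyadic_step p i)"]
    by blast
  define f where "f = (\<lambda>n. r * step_sum p x n)"
  have f: "f \<in> dyadic_functions"
    unfolding f_def by (intro dyadic_functions_scale step_sum_in)
  have "real (2 ^ p) \<le> real (card {i\<in>{..<2 ^ p}. \<bar>x i\<bar> = 1} + n)"
    using x(3) by (rule of_nat_mono)
  also have "\<dots> = (\<Sum>i\<in>{i\<in>{..<2 ^ p}. \<bar>x i\<bar> = 1}. \<bar>x i\<bar>) + real n"
    by simp
  also have "\<dots> \<le> (\<Sum>i<2 ^ p. \<bar>x i\<bar>) + real n"
    by (intro add_right_mono sum_mono2) auto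
  finally have "(2 ^ p - real n) / 2 ^ p \<le> (\<Sum>i<2 ^ p. \<bar>x i\<bar>) / 2 ^ p"
    by (intro divide_right_mono) auto
  then have "1 - real n / 2 ^ p \<le> (\<Sum>i<2 ^ p. \<bar>x i\<bar>) / 2 ^ p"
    by (simp add: diff_divide_distrib)
  also have "\<dots> \<le> mean_abs (step_sum p x)" by (rule mean_abs_step_sum)
  finally have "r * (1 - real n / 2 ^ p) \<le> mean_abs f"
    unfolding f_def mean_abs_scale[OF step_sum_in] using r by (simp add: mult_left_mono)
  moreover have "sup_norm f \<le> r"
    unfolding f_def sup_norm_scale[OF step_sum_in]
    using r sup_norm_step_sum[OF x(1), of p] by (simp add: mult_left_le)
  moreover have "T j f = 0" if "j < n" for j
  proof -
    have "T j f = r * T j (step_sum p x)"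
      using T[OF that] step_sum_in by (auto simp: f_def linear_functionals_def linear_operator_def)
    also have "T j (step_sum p x) = 0"
      unfolding step_sum_def[abs_def]
      using linear_functional_sum[OF T[OF that], of "{..<2 ^ p}" "dyadic_step p" x] dyadic_step_in x(2) that by simp
    finally show ?thesis by simp
  qed
  ultimately show ?thesis using f by blast
qed

text \<open>If the error were \<open>e < 1 / 2\<close>, the common output \<open>g\<close> for zero
  data would be within \<open>e\<close> of the mean 0 of the zero function and of the mean of a
  kernel function, so the latter would be at most \<open>2 * e\<close>. But such means come
  arbitrarily close to 1.\<close>

lemma wor_error_mean_abs_ge:
  assumes A: "A \<in> det_algs (linear_functionals dyadic_space) constants_space n"
  shows "ennreal (1 / 2) \<le> wor_error dyadic_space constants_space mean_abs_op A"
proof (rule ccontr)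
  assume "\<not> ?thesis"
  then have less: "wor_error dyadic_space constants_space mean_abs_op A < ennreal (1 / 2)"
    by (simp only: not_le)
  then obtain e where e: "0 \<le> e" "wor_error dyadic_space constants_space mean_abs_op A = ennreal e"
    by (cases "wor_error dyadic_space constants_space mean_abs_op A") auto
  have "e < 1 / 2" using less ennreal_less_iff[OF e(1)] unfolding e(2) by blast
  obtain L \<phi> where L: "\<And>ys. length ys < n \<Longrightarrow> L ys \<in> linear_functionals dyadic_space"
    and A_eq: "A = (\<lambda>f. \<phi> (info L f n))"
    using A by (auto simp: det_algs_def)
  \<comment> \<open>The norm of \<open>constants_space\<close> reads entry 0, so an output enters
    the error through this entry.\<close>
  define g where "g = \<phi> (replicate n 0) 0"
  have A_g: "A f 0 = g" if "\<And>j. j < n \<Longrightarrow> L (replicate j 0) f = 0" for f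
    unfolding A_eq g_def using info_replicate_zero[of n L f n] that by simp
  have err: "\<bar>mean_abs f - g\<bar> \<le> e"
    if "f \<in> dyadic_functions" "sup_norm f < 1" "\<And>j. j < n \<Longrightarrow> L (replicate j 0) f = 0" for f
  proof -
    have "ennreal (vnorm constants_space (vdiff constants_space (mean_abs_op f) (A f)))
        \<le> wor_error dyadic_space constants_space mean_abs_op A"
      unfolding wor_error_def by (rule SUP_upper) (use that in \<open>simp add: open_unit_ball_def\<close>)
    then show ?thesis using e A_g[OF that(3)] by (simp add: mean_abs_op_def)
  qed
  have "\<bar>g\<bar> \<le> e"
    using err[of "\<lambda>_. 0"] linear_functional_zero L
    by (simp add: dyadic_functions_zero mean_abs_zero sup_norm_def)
  \<comment> \<open>The parameter \<open>p\<close> plays two roles, radius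
    \<open>1 - (1 / 2) ^ p\<close> below 1 and number of pieces \<open>2 ^ p\<close>, so that a
    single limit yields \<open>1 \<le> 2 * e\<close>.\<close>
  have "(1 - (1 / 2) ^ p) * (1 - real n * (1 / 2) ^ p) \<le> 2 * e" for p
  proof -
    obtain f where f: "f \<in> dyadic_functions" "sup_norm f \<le> 1 - (1 / 2) ^ p"
      "\<forall>j<n. L (replicate j 0) f = 0" "(1 - (1 / 2) ^ p) * (1 - real n / 2 ^ p) \<le> mean_abs f"
      using kernel_large_mean_abs[of n "\<lambda>j. L (replicate j 0)" "1 - (1 / 2) ^ p" p] L
      by (auto simp: power_le_one)
    have "0 < (1 / 2 :: real) ^ p" by simp
    then have "\<bar>mean_abs f - g\<bar> \<le> e" using f by (intro err) (auto intro: le_less_trans)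
    then have "mean_abs f \<le> 2 * e" using \<open>\<bar>g\<bar> \<le> e\<close> by linarith
    moreover have "real n / 2 ^ p = real n * (1 / 2) ^ p" by (simp add: power_divide)
    ultimately show ?thesis using f(4) by simp
  qed
  moreover have "(\<lambda>p. (1 - (1 / 2) ^ p) * (1 - real n * (1 / 2) ^ p)) \<longlonglongrightarrow> (1 - 0) * (1 - real n * 0)"
    by (intro tendsto_intros LIMSEQ_power_zero) auto
  ultimately have "1 \<le> 2 * e" by (auto intro: LIMSEQ_le_const2)
  then show False using \<open>e < 1 / 2\<close> by simp
qed

lemma zero_continuous_linear: "(\<lambda>_. 0) \<in> continuous_linear_functionals dyadic_space"
  by (simp add: continuous_linear_functionals_def linear_functionals_def linear_operator_def)

text \<open>Leaving the class open between the zero functional and all linear functionals treats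
  both worst case numbers at once. For the upper bound the output is the midpoint of the range of
  means on the open ball, and the zero functional fills the \<open>n\<close> evaluations that an
  algorithm has to make.\<close>

lemma e_wor_mean_abs:
  assumes "\<Lambda> \<subseteq> linear_functionals dyadic_space" "(\<lambda>_. 0) \<in> \<Lambda>"
  shows "e_wor \<Lambda> dyadic_space constants_space mean_abs_op n = ennreal (1 / 2)"
proof (rule antisym)
  define A where "A = (\<lambda>_::nat \<Rightarrow> real. (\<lambda>_::nat. 1 / 2 :: real))"
  have "A \<in> det_algs \<Lambda> constants_space n"
    unfolding det_algs_def mem_Collect_eq using assms(2)
    by (intro exI[of _ "\<lambda>_::real list. \<lambda>_::nat \<Rightarrow> real. 0 :: real"]
        exI[of _ "\<lambda>_::real list. \<lambda>_::nat. 1 / 2 :: real"]) (auto simp: A_def)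
  then have "e_wor \<Lambda> dyadic_space constants_space mean_abs_op n
      \<le> wor_error dyadic_space constants_space mean_abs_op A"
    unfolding e_wor_def by (rule INF_lower)
  also have "\<dots> \<le> ennreal (1 / 2)"
    unfolding wor_error_def
  proof (intro SUP_least ennreal_leI)
    fix f assume "f \<in> open_unit_ball dyadic_space"
    then have "0 \<le> mean_abs f" "mean_abs f < 1"
      using mean_abs_bounds[of f] by (auto simp: open_unit_ball_def)
    then have "\<bar>mean_abs f - 1 / 2\<bar> \<le> 1 / 2" by linarith
    then show "vnorm constants_space (vdiff constants_space (mean_abs_op f) (A f)) \<le> 1 / 2"
      by (simp add: mean_abs_op_def A_def)
  qed
  finally show "e_wor \<Lambda> dyadic_space constants_space mean_abs_op n \<le> ennreal (1 / 2)" .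
  have "det_algs \<Lambda> constants_space n \<subseteq> det_algs (linear_functionals dyadic_space) constants_space n"
    unfolding det_algs_def using assms(1) by blast
  then show "ennreal (1 / 2) \<le> e_wor \<Lambda> dyadic_space constants_space mean_abs_op n"
    unfolding e_wor_def by (intro INF_greatest wor_error_mean_abs_ge) auto
qed

section \<open>Randomized error\<close>

text \<open>The number of values already computed is the index of the next sample point, so the list
  serves only as a counter until the output is formed.\<close>

definition Monte_Carlo :: "nat \<Rightarrow> (nat \<Rightarrow> real, nat \<Rightarrow> real, nat \<Rightarrow> real) ran_alg" where
  "Monte_Carlo n = \<lparr>rprob = Pi\<^sub>M {..<n} (\<lambda>_. unit_uniform),
    rfun = (\<lambda>\<omega> ys. point_value (\<omega> (length ys))),
    rstop = (\<lambda>\<omega> ys. length ys = n),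
    rout = (\<lambda>\<omega> ys _. sum_list (map abs ys) / real n)\<rparr>"

lemma rprob_Monte_Carlo: "rprob (Monte_Carlo n) = Pi\<^sub>M {..<n} (\<lambda>_. unit_uniform)"
  by (simp add: Monte_Carlo_def)

lemma num_funs_Monte_Carlo: "num_funs (Monte_Carlo n) f \<omega> = n"
  unfolding num_funs_def Monte_Carlo_def by (simp add: Least_equality)

lemma ran_output_Monte_Carlo:
  "ran_output (Monte_Carlo n) f \<omega> = (\<lambda>_. (\<Sum>j<n. \<bar>point_value (\<omega> j) f\<bar>) / real n)"
proof -
  have "sum_list (map abs (info (\<lambda>ys. point_value (\<omega> (length ys))) f k)) = (\<Sum>j<k. \<bar>point_value (\<omega> j) f\<bar>)" for k
    by (induction k) auto
  then show ?thesis
    unfolding ran_output_def num_funs_Monte_Carlo by (simp add: Monte_Carlo_def)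
qed

lemma Monte_Carlo_ran_alg:
  "Monte_Carlo n \<in> ran_algs (continuous_linear_functionals dyadic_space) dyadic_space constants_space"
proof -
  define P where "P = Pi\<^sub>M {..<n} (\<lambda>_. unit_uniform)"
  have P: "rprob (Monte_Carlo n) = P" by (simp add: rprob_Monte_Carlo P_def)
  have "prob_space P"
    unfolding P_def by (intro prob_space_PiM prob_space_unit_uniform)
  \<comment> \<open>Lists of length \<open>n\<close> or more address a coordinate outside the index
    set of the product, where \<omega> is \<open>undefined\<close>. The result is still evaluation
    at some real number, hence admissible.\<close>
  moreover have "rfun (Monte_Carlo n) \<omega> ys \<in> continuous_linear_functionals dyadic_space" for \<omega> ys
    by (simp add: Monte_Carlo_def point_value_continuous_linear)
  moreover have "rout (Monte_Carlo n) \<omega> ys \<in> carr constants_space" for \<omega> ys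
    by (simp add: Monte_Carlo_def)
  moreover have "\<exists>k. rstop (Monte_Carlo n) \<omega> (info (rfun (Monte_Carlo n) \<omega>) f k)" for \<omega> f
    by (simp add: Monte_Carlo_def)
  moreover have "(\<lambda>(f, \<omega>). num_funs (Monte_Carlo n) f \<omega>) \<in> measurable (nborel dyadic_space \<Otimes>\<^sub>M P) (count_space UNIV)"
    by (simp add: num_funs_Monte_Carlo)
  moreover have "(\<lambda>(f, \<omega>). ran_output (Monte_Carlo n) f \<omega>) \<in> measurable (nborel dyadic_space \<Otimes>\<^sub>M P) (nborel constants_space)"
  proof -
    have "(\<lambda>\<omega>. \<omega> j) \<in> borel_measurable P" if "j < n" for j
    proof -
      have "(\<lambda>\<omega>. \<omega> j) \<in> measurable P unit_uniform"
        unfolding P_def using that by (intro measurable_component_singleton) simp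
      then show ?thesis by (simp add: unit_uniform_def cong: measurable_cong_sets)
    qed
    then have "(\<lambda>x. (\<Sum>j<n. \<bar>point_value (snd x j) (fst x)\<bar>) / real n)
        \<in> borel_measurable (nborel dyadic_space \<Otimes>\<^sub>M P)"
      using point_value_measurable2[of "\<lambda>\<omega>. \<omega> j" P for j]
      by (intro borel_measurable_divide borel_measurable_const borel_measurable_sum borel_measurable_abs)
        (simp add: case_prod_beta)
    then show ?thesis
      unfolding ran_output_Monte_Carlo case_prod_beta
      by (rule measurable_compose[OF _ constants_measurable])
  qed
  ultimately show ?thesis unfolding ran_algs_def mem_Collect_eq P by blast
qed

lemma ran_card_Monte_Carlo: "ran_card dyadic_space (Monte_Carlo n) \<le> of_nat n"
proof -
  interpret prob_space "rprob (Monte_Carlo n)"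
    using Monte_Carlo_ran_alg[of n] by (simp add: ran_algs_def)
  show ?thesis
    unfolding ran_card_def num_funs_Monte_Carlo
    by (intro SUP_least) (simp add: emeasure_space_1)
qed

lemma ran_error_Monte_Carlo:
  assumes "0 < n"
  shows "ran_error dyadic_space constants_space mean_abs_op (Monte_Carlo n) \<le> ennreal (1 / sqrt (real n))"
  unfolding ran_error_def
proof (rule SUP_least)
  fix f assume "f \<in> open_unit_ball dyadic_space"
  then have f: "f \<in> dyadic_functions" "sup_norm f < 1" by (auto simp: open_unit_ball_def)
  define I where "I = (\<integral>\<^sup>+\<omega>. ennreal ((vnorm constants_space (vdiff constants_space (mean_abs_op f)
    (ran_output (Monte_Carlo n) f \<omega>)))\<^sup>2) \<partial>rprob (Monte_Carlo n))"
  have "\<bar>point_value u f\<bar> \<le> 1" for u using abs_point_value_le[OF f(1), of u] f(2) by simp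
  then have "I \<le> ennreal (1 / real n)"
    unfolding I_def
    using Monte_Carlo_mean_square_error[OF prob_space_unit_uniform _ _ _ assms,
        of "\<lambda>u. \<bar>point_value u f\<bar>"] point_value_measurable[of f]
    by (simp add: ran_output_Monte_Carlo mean_abs_op_def mean_abs_def rprob_Monte_Carlo)
  \<comment> \<open>\<open>ennreal_sqrt\<close> treats infinity separately, so finiteness has to be
    known before passing to the real square root.\<close>
  then have "I \<noteq> \<infinity>" "enn2real I \<le> 1 / real n"
    by (auto simp: top_unique enn2real_leI)
  then have "ennreal_sqrt I \<le> ennreal (sqrt (1 / real n))"
    unfolding ennreal_sqrt_def by (simp add: ennreal_leI del: real_sqrt_divide)
  then show "ennreal_sqrt (\<integral>\<^sup>+\<omega>. ennreal ((vnorm constants_space (vdiff constants_space (mean_abs_op f)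
    (ran_output (Monte_Carlo n) f \<omega>)))\<^sup>2) \<partial>rprob (Monte_Carlo n)) \<le> ennreal (1 / sqrt (real n))"
    by (simp add: I_def real_sqrt_divide)
qed

lemma e_ran_mean_abs_tendsto:
  "(\<lambda>n. e_ran TYPE(nat \<Rightarrow> real) (continuous_linear_functionals dyadic_space)
    dyadic_space constants_space mean_abs_op n) \<longlonglongrightarrow> 0"
proof (rule tendsto_sandwich[OF _ _ tendsto_const])
  \<comment> \<open>At \<open>n = 0\<close> the right-hand side is 0 by the convention for division
    by zero, so the bound is claimed only for positive \<open>n\<close>.\<close>
  show "\<forall>\<^sub>F n in sequentially. e_ran TYPE(nat \<Rightarrow> real) (continuous_linear_functionals dyadic_space)
      dyadic_space constants_space mean_abs_op n \<le> ennreal (1 / sqrt (real n))"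
    using eventually_gt_at_top[of 0]
  proof eventually_elim
    case (elim n)
    have "e_ran TYPE(nat \<Rightarrow> real) (continuous_linear_functionals dyadic_space)
        dyadic_space constants_space mean_abs_op n
      \<le> ran_error dyadic_space constants_space mean_abs_op (Monte_Carlo n)"
      unfolding e_ran_def
      by (rule INF_lower) (simp add: Monte_Carlo_ran_alg ran_card_Monte_Carlo)
    also have "\<dots> \<le> ennreal (1 / sqrt (real n))" using elim by (rule ran_error_Monte_Carlo)
    finally show ?case .
  qed
  have "(\<lambda>n. 1 / sqrt (real n)) \<longlonglongrightarrow> 0"
    by (intro tendsto_divide_0[OF tendsto_const] filterlim_at_top_imp_at_infinity
        filterlim_compose[OF sqrt_at_top filterlim_real_sequentially])
  then show "(\<lambda>n. ennreal (1 / sqrt (real n))) \<longlonglongrightarrow> 0"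
    using tendsto_ennrealI by fastforce
qed simp

text \<open>The operator is even, and an even linear map vanishes.\<close>

lemma mean_abs_op_nonlinear: "\<not> linear_operator dyadic_space constants_space mean_abs_op"
proof
  assume "linear_operator dyadic_space constants_space mean_abs_op"
  then have "mean_abs_op (\<lambda>n. - 1 * f n) = (\<lambda>n. - 1 * mean_abs_op f n)" if "f \<in> dyadic_functions" for f
    using that unfolding linear_operator_def dyadic_space_simps constants_space_simps by blast
  then have "mean_abs f = 0" if "f \<in> dyadic_functions" for f
    using that mean_abs_scale[OF that, of "- 1"] by (simp add: mean_abs_op_def fun_eq_iff)
  \<comment> \<open>With no functionals, one piece and radius 1, the kernel lemma supplies a
    function of mean absolute value at least 1.\<close>
  moreover obtain f where "f \<in> dyadic_functions" "1 * (1 - real 0 / 2 ^ 0) \<le> mean_abs f"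
    using kernel_large_mean_abs[where n = 0 and r = 1 and p = 0] by auto
  ultimately show False by simp
qed

theorem mainTheorem3:
  shows "\<exists>(F :: (nat \<Rightarrow> real) nspace) (G :: (nat \<Rightarrow> real) nspace) S.
    real_normed_space F \<and> real_normed_space G \<and>
    continuous_map (ntop F) (ntop G) S \<and> \<not> linear_operator F G S \<and>
    (\<exists>l::real. 0 < l \<and>
       (\<lambda>n. e_wor (linear_functionals F) F G S n) \<longlonglongrightarrow> ennreal l \<and>
       (\<lambda>n. e_wor (continuous_linear_functionals F) F G S n) \<longlonglongrightarrow> ennreal l) \<and>
    (\<lambda>n. e_ran TYPE(nat \<Rightarrow> real) (continuous_linear_functionals F) F G S n) \<longlonglongrightarrow> 0"
proof (intro exI conjI)
  have sub: "continuous_linear_functionals dyadic_space \<subseteq> linear_functionals dyadic_space"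
    by (auto simp: continuous_linear_functionals_def)
  show "(\<lambda>n. e_wor (linear_functionals dyadic_space) dyadic_space constants_space mean_abs_op n)
      \<longlonglongrightarrow> ennreal (1 / 2)"
    using e_wor_mean_abs[of "linear_functionals dyadic_space"] sub zero_continuous_linear by auto
  show "(\<lambda>n. e_wor (continuous_linear_functionals dyadic_space) dyadic_space constants_space mean_abs_op n)
      \<longlonglongrightarrow> ennreal (1 / 2)"
    using e_wor_mean_abs[OF sub zero_continuous_linear] by simp
qed (simp_all add: real_normed_space_dyadic real_normed_space_constants mean_abs_op_continuous
  mean_abs_op_nonlinear e_ran_mean_abs_tendsto)

end
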